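(* Let $\mathcal{X}$ be a Hilbert $C^*$-module over a $C^*$-algebra $\mathcal{A}$ and let $x,y,u,v,u',v'\in\mathcal{X}$ satisfy ${\rm Re}\langle x-u,v-x\rangle\geq0$ and ${\rm Re}\langle y-u',v'-y\rangle\geq0$. Let $K\in\mathcal{L}(\mathcal{X})$ be a projection such that $u+v\in{\rm ran}(K)$ and $u'+v'\in{\rm ran}(K)$. Then \[ \big|\langle x,y\rangle-\langle Kx,y\rangle\big|\leq \Big\|\tfrac14|v-u|^2-{\rm Re}\langle x-u,v-x\rangle\Big\|^{1/2}\Big(\tfrac14|v'-u'|^2-{\rm Re}\langle y-u',v'-y\rangle\Big)^{1/2}\leq \tfrac14\|v-u\|\,|v'-u'|. \]
   Context: $\langle\cdot,\cdot\rangle$ is the $\mathcal{A}$-valued inner product, $\mathcal{A}$-linear in the second variable. For $z\in\mathcal{X}$, $|z|=\langle z,z\rangle^{1/2}\in\mathcal{A}$ and $\|z\|=\|\langle z,z\rangle\|^{1/2}$; for $a\in\mathcal{A}$, $|a|=(a^*a)^{1/2}$ and ${\rm Re}\,a=(a+a^* )/2$. $\mathcal{L}(\mathcal{X})$ is the $C^*$-algebra of adjointable maps on $\mathcal{X}$. *)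

theory Defs
  imports "HOL-Analysis.Analysis"
begin

class cvector = real_vector +
  fixes cscale :: "complex \<Rightarrow> 'a \<Rightarrow> 'a" (infixr \<open>*\<^sub>C\<close> 75)
  assumes cscale_add_right: "c *\<^sub>C (x + y) = c *\<^sub>C x + c *\<^sub>C y"
    and cscale_add_left: "(c + d) *\<^sub>C x = c *\<^sub>C x + d *\<^sub>C x"
    and cscale_cscale: "c *\<^sub>C (d *\<^sub>C x) = (c * d) *\<^sub>C x"
    and cscale_one: "1 *\<^sub>C x = x"
    and scaleR_cscale: "r *\<^sub>R x = complex_of_real r *\<^sub>C x"

class cstar_algebra = cvector + real_normed_algebra + banach +
  fixes cstar :: "'a \<Rightarrow> 'a"
  assumes norm_cscale: "norm (c *\<^sub>C x) = cmod c * norm x"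
    and mult_cscale_left: "(c *\<^sub>C x) * y = c *\<^sub>C (x * y)"
    and mult_cscale_right: "x * (c *\<^sub>C y) = c *\<^sub>C (x * y)"
    and cstar_add: "cstar (x + y) = cstar x + cstar y"
    and cstar_cscale: "cstar (c *\<^sub>C x) = cnj c *\<^sub>C cstar x"
    and cstar_mult: "cstar (x * y) = cstar y * cstar x"
    and cstar_cstar: "cstar (cstar x) = x"
    and cstar_identity: "norm (cstar x * x) = norm x * norm x"

definition cpos :: "'a::cstar_algebra \<Rightarrow> bool" where
  "cpos a \<longleftrightarrow> (\<exists>b. a = cstar b * b)"

definition cle :: "'a::cstar_algebra \<Rightarrow> 'a \<Rightarrow> bool" where
  "cle a b \<longleftrightarrow> cpos (b - a)"

definition cstar_sqrt :: "'a::cstar_algebra \<Rightarrow> 'a" where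
  "cstar_sqrt a = (THE b. cpos b \<and> b * b = a)"

definition cabs :: "'a::cstar_algebra \<Rightarrow> 'a" where
  "cabs a = cstar_sqrt (cstar a * a)"

definition cRe :: "'a::cstar_algebra \<Rightarrow> 'a" where
  "cRe a = (1/2) *\<^sub>R (a + cstar a)"

definition hilbert_cstar_module ::
  "('x::cvector \<Rightarrow> 'x \<Rightarrow> 'a::cstar_algebra) \<Rightarrow> ('x \<Rightarrow> 'a \<Rightarrow> 'x) \<Rightarrow> bool" where
  "hilbert_cstar_module ip rm \<longleftrightarrow>
     (\<forall>x y a. rm (x + y) a = rm x a + rm y a) \<and>
     (\<forall>x a b. rm x (a + b) = rm x a + rm x b) \<and>
     (\<forall>x a b. rm x (a * b) = rm (rm x a) b) \<and>
     (\<forall>c x a. rm (c *\<^sub>C x) a = c *\<^sub>C rm x a \<and> rm x (c *\<^sub>C a) = c *\<^sub>C rm x a) \<and>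
     (\<forall>x y z. ip x (y + z) = ip x y + ip x z) \<and>
     (\<forall>c x y. ip x (c *\<^sub>C y) = c *\<^sub>C ip x y) \<and>
     (\<forall>x y a. ip x (rm y a) = ip x y * a) \<and>
     (\<forall>x y. cstar (ip x y) = ip y x) \<and>
     (\<forall>x. cpos (ip x x)) \<and>
     (\<forall>x. ip x x = 0 \<longrightarrow> x = 0) \<and>
     (\<forall>f::nat \<Rightarrow> 'x.
        (\<forall>e>0. \<exists>N. \<forall>m\<ge>N. \<forall>n\<ge>N. norm (ip (f m - f n) (f m - f n)) < e) \<longrightarrow>
        (\<exists>l. (\<lambda>n. norm (ip (f n - l) (f n - l))) \<longlonglongrightarrow> 0))"

definition mabs :: "('x \<Rightarrow> 'x \<Rightarrow> 'a::cstar_algebra) \<Rightarrow> 'x \<Rightarrow> 'a" where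
  "mabs ip z = cstar_sqrt (ip z z)"

definition mnorm :: "('x \<Rightarrow> 'x \<Rightarrow> 'a::cstar_algebra) \<Rightarrow> 'x \<Rightarrow> real" where
  "mnorm ip z = sqrt (norm (ip z z))"

definition adjointable :: "('x \<Rightarrow> 'x \<Rightarrow> 'a::cstar_algebra) \<Rightarrow> ('x \<Rightarrow> 'x) \<Rightarrow> bool" where
  "adjointable ip K \<longleftrightarrow> (\<exists>K'. \<forall>x y. ip (K x) y = ip x (K' y))"

definition module_projection :: "('x \<Rightarrow> 'x \<Rightarrow> 'a::cstar_algebra) \<Rightarrow> ('x \<Rightarrow> 'x) \<Rightarrow> bool" where
  "module_projection ip K \<longleftrightarrow> adjointable ip K \<and> (\<forall>x y. ip (K x) y = ip x (K y)) \<and> K \<circ> K = K"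

end

theory Submission
  imports Defs
begin

text \<open>
  Put \<open>w = x - (u + v)/2\<close> and \<open>w' = y - (u' + v')/2\<close>. Since \<open>K\<close> fixes both midpoints, they cancel
  from \<open>\<langle>x, y\<rangle> - \<langle>Kx, y\<rangle>\<close>, which becomes \<open>\<langle>w - Kw, w'\<rangle>\<close>, while \<open>|v - u|\<^sup>2/4 - Re \<langle>x - u, v - x\<rangle>\<close> is
  \<open>\<langle>w, w\<rangle>\<close>. The first inequality is then the operator-valued Cauchy--Schwarz inequality combined with
  the operator monotonicity of the square root, and the second follows from
  \<open>\<langle>w, w\<rangle> \<le> |v - u|\<^sup>2/4\<close> and its analogue for \<open>w'\<close>.

  The facts on positive elements used here are obtained without spectral theory. In a unital algebra
  a self-adjoint \<open>h\<close> is positive iff \<open>\<parallel>t - h\<parallel> \<le> t\<close> for some \<open>t\<close>; square roots come from the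
  iteration \<open>s \<mapsto> (g + s\<^sup>2)/2\<close>, which converges to \<open>1 - (1 - g)\<^bsup>1/2\<^esup>\<close>; and the bound
  \<open>\<parallel>a\<parallel>\<^sup>2 \<le> \<parallel>a\<^sup>2 + k\<^sup>2\<parallel>\<close> for commuting self-adjoint elements replaces the functional calculus. The
  general case is reduced to the unital one by adjoining a unit.
\<close>

subsection \<open>The involution and the norm\<close>

lemma cscale_zero_left [simp]: "0 *\<^sub>C (x::'a::cvector) = 0"
  using cscale_add_left [of 0 0 x] by simp

lemma cscale_zero_right [simp]: "c *\<^sub>C (0::'a::cvector) = 0"
  using cscale_add_right [of c "0::'a" 0] by simp

lemma cscale_minus_right: "c *\<^sub>C (- x) = - (c *\<^sub>C (x::'a::cvector))"
  using cscale_add_right [of c x "- x"] by (simp add: eq_neg_iff_add_eq_0 add.commute)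

lemma cscale_diff_right: "c *\<^sub>C (x - y) = c *\<^sub>C x - c *\<^sub>C (y::'a::cvector)"
  using cscale_add_right [of c x "- y"] by (simp add: cscale_minus_right)

lemma cscale_minus_left: "(- c) *\<^sub>C x = - (c *\<^sub>C (x::'a::cvector))"
  using cscale_add_left [of c "- c" x] by (simp add: eq_neg_iff_add_eq_0 add.commute)

lemma cstar_zero [simp]: "cstar (0::'a::cstar_algebra) = 0"
  using cstar_add [of "0::'a" 0] by simp

lemma cstar_minus: "cstar (- x) = - cstar (x::'a::cstar_algebra)"
  using cstar_add [of x "- x"] by (simp add: eq_neg_iff_add_eq_0 add.commute)

lemma cstar_diff: "cstar (x - y) = cstar x - cstar (y::'a::cstar_algebra)"
  using cstar_add [of x "- y"] by (simp add: cstar_minus)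

lemma cstar_scaleR: "cstar (r *\<^sub>R x) = r *\<^sub>R cstar (x::'a::cstar_algebra)"
  by (simp add: scaleR_cscale cstar_cscale)

text \<open>The C*-identity and submultiplicativity give
  \<open>norm y * norm y \<le> norm (cstar y) * norm y\<close>. Cancelling and applying this to both
  \<open>x\<close> and \<open>cstar x\<close> yields equality.\<close>

lemma norm_cstar [simp]: "norm (cstar x) = norm (x::'a::cstar_algebra)"
proof -
  have le: "norm y \<le> norm (cstar y)" for y :: 'a
  proof (cases "y = 0")
    case False
    have "norm y * norm y \<le> norm (cstar y) * norm y"
      by (metis cstar_identity norm_mult_ineq)
    with False show ?thesis
      by simp
  qed simp
  show ?thesis
    using le [of x] le [of "cstar x"] by (simp add: cstar_cstar)
qed

lemma cstar_mult_self_eq_0: "cstar x * x = 0 \<Longrightarrow> x = (0::'a::cstar_algebra)"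
  using cstar_identity [of x] by simp

lemma norm_square_selfadjoint:
  "cstar a = a \<Longrightarrow> norm (a * a) = norm a * norm (a::'a::cstar_algebra)"
  by (metis cstar_identity)

lemma bounded_linear_cstar: "bounded_linear (cstar :: 'a::cstar_algebra \<Rightarrow> 'a)"
  by (rule bounded_linear_intro [where K = 1]) (simp_all add: cstar_add cstar_scaleR)

text \<open>Read off from the normal element \<open>a + \<i> k\<close>, whose real part is \<open>a\<close>.\<close>
lemma norm_le_norm_sum_squares:
  fixes a k :: "'a::cstar_algebra"
  assumes "cstar a = a" "cstar k = k" "a * k = k * a"
  shows "norm a * norm a \<le> norm (a * a + k * k)"
proof -
  define w where "w = a + \<i> *\<^sub>C k"
  have cw: "cstar w = a - \<i> *\<^sub>C k"
    by (simp add: w_def cstar_add cstar_cscale assms cscale_minus_left)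
  have "cstar w * w = a * a + k * k"
    unfolding cw by (simp add: w_def ring_distribs mult_cscale_left mult_cscale_right assms
        cscale_cscale cscale_minus_left cscale_one cscale_diff_right)
  then have n: "norm w * norm w = norm (a * a + k * k)"
    by (metis cstar_identity)
  have "2 *\<^sub>R a = w + cstar w"
    unfolding cw by (simp add: w_def scaleR_2)
  then have "2 * norm a \<le> norm w + norm (cstar w)"
    by (metis norm_triangle_ineq norm_scaleR abs_numeral)
  then have "norm a \<le> norm w"
    by simp
  then show ?thesis
    using n mult_mono' by fastforce
qed

subsection \<open>Square roots by iteration\<close>

text \<open>A limit \<open>s\<close> satisfies \<open>(1 - s)^2 = 1 - g\<close>. The same iteration
  over the reals with \<open>g = 1\<close> serves as a majorant for every \<open>g\<close> of norm
  at most 1.\<close>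

primrec sqrt_iter :: "'a::real_algebra \<Rightarrow> nat \<Rightarrow> 'a" where
  "sqrt_iter g 0 = 0"
| "sqrt_iter g (Suc n) = (1/2) *\<^sub>R (g + sqrt_iter g n * sqrt_iter g n)"

lemma sqrt_iter_commute:
  assumes "c * g = g * c"
  shows "c * sqrt_iter g n = sqrt_iter g n * c"
proof (induction n)
  case (Suc n)
  then have "c * (sqrt_iter g n * sqrt_iter g n) = sqrt_iter g n * sqrt_iter g n * c"
    by (metis mult.assoc)
  with assms show ?case
    by (simp add: ring_distribs)
qed simp

lemma sqrt_iter_real_bounds: "0 \<le> sqrt_iter (1::real) n \<and> sqrt_iter (1::real) n \<le> 1"
proof (induction n)
  case (Suc n)
  then have "sqrt_iter (1::real) n * sqrt_iter 1 n \<le> 1 * 1"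
    by (intro mult_mono) auto
  then show ?case
    by (auto intro: add_nonneg_nonneg)
qed simp

lemma norm_sqrt_iter_le:
  fixes g :: "'a::real_normed_algebra"
  assumes "norm g \<le> 1"
  shows "norm (sqrt_iter g n) \<le> sqrt_iter 1 n"
proof (induction n)
  case (Suc n)
  have "norm (sqrt_iter g n * sqrt_iter g n) \<le> sqrt_iter 1 n * sqrt_iter 1 n"
    by (meson Suc.IH mult_mono' norm_ge_zero norm_mult_ineq order_trans)
  with assms have "norm (g + sqrt_iter g n * sqrt_iter g n) \<le> 1 + sqrt_iter 1 n * sqrt_iter 1 n"
    by (meson add_mono norm_triangle_le)
  then show ?case
    by simp
qed simp

text \<open>Each new increment is half of \<open>(a - b) * (a + b)\<close>, and both factors have
  scalar majorants. The scalar increments telescope, so convergence follows even for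
  \<open>norm g = 1\<close>, where no geometric rate is at hand.\<close>

lemma norm_sqrt_iter_Suc_diff_le:
  fixes g :: "'a::real_normed_algebra"
  assumes "norm g \<le> 1"
  shows "norm (sqrt_iter g (Suc n) - sqrt_iter g n) \<le> sqrt_iter 1 (Suc n) - sqrt_iter 1 n"
proof (induction n)
  case 0
  then show ?case using assms by simp
next
  case (Suc n)
  define a b where "a = sqrt_iter g (Suc n)" and "b = sqrt_iter g n"
  define \<alpha> \<beta> :: real where "\<alpha> = sqrt_iter 1 (Suc n)" and "\<beta> = sqrt_iter 1 n"
  have "g * b = b * g"
    unfolding b_def by (rule sqrt_iter_commute) simp
  then have comm: "a * b = b * a"
    unfolding a_def using sqrt_iter_commute [of b g] by metis
  have "norm ((a - b) * (a + b)) \<le> (\<alpha> - \<beta>) * (\<alpha> + \<beta>)"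
  proof -
    have "norm (a + b) \<le> \<alpha> + \<beta>"
      unfolding a_def b_def \<alpha>_def \<beta>_def
      by (meson add_mono norm_triangle_le norm_sqrt_iter_le assms)
    moreover have "norm (a - b) \<le> \<alpha> - \<beta>"
      using Suc unfolding a_def b_def \<alpha>_def \<beta>_def .
    ultimately show ?thesis
      by (meson mult_mono' norm_ge_zero norm_mult_ineq order_trans)
  qed
  moreover have "sqrt_iter g (Suc (Suc n)) - a = (1/2) *\<^sub>R ((a - b) * (a + b))"
  proof -
    have "sqrt_iter g (Suc (Suc n)) = (1/2) *\<^sub>R (g + a * a)"
      by (simp add: a_def)
    moreover have "a = (1/2) *\<^sub>R (g + b * b)"
      by (simp add: a_def b_def)
    ultimately have "sqrt_iter g (Suc (Suc n)) - a = (1/2) *\<^sub>R ((g + a * a) - (g + b * b))"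
      by (metis scaleR_right_diff_distrib)
    then show ?thesis
      by (simp add: ring_distribs comm)
  qed
  moreover have "sqrt_iter 1 (Suc (Suc n)) - \<alpha> = (1/2) * ((\<alpha> - \<beta>) * (\<alpha> + \<beta>))"
    by (simp add: \<alpha>_def \<beta>_def field_simps)
  ultimately show ?case
    by (simp add: a_def \<alpha>_def)
qed

text \<open>The element \<open>1 - s\<close> is a square root of \<open>1 - g\<close>; no unit is needed to construct \<open>s\<close>.\<close>
lemma sqrt_one_minus_exists:
  fixes g :: "'a::cstar_algebra"
  assumes "cstar g = g" "norm g \<le> 1"
  obtains s where "cstar s = s" "norm s \<le> 1" "s + s = g + s * s"
    "\<And>c. c * g = g * c \<Longrightarrow> c * s = s * c"
proof -
  define \<sigma> :: "nat \<Rightarrow> real" where "\<sigma> = sqrt_iter 1"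
  have mono: "incseq \<sigma>"
    unfolding incseq_Suc_iff \<sigma>_def
    by (metis norm_sqrt_iter_Suc_diff_le assms(2) diff_ge_0_iff_ge norm_ge_zero order_trans)
  \<comment> \<open>The scalar iterates increase and stay below 1, so their increments are summable
    and dominate those in the algebra.\<close>
  have "convergent \<sigma>"
    using sqrt_iter_real_bounds by (intro Bseq_mono_convergent BseqI' [where K = 1])
      (auto simp: \<sigma>_def mono incseqD [OF mono, unfolded \<sigma>_def])
  then have "summable (\<lambda>n. \<sigma> (Suc n) - \<sigma> n)"
    using telescope_summable by (auto simp: convergent_def)
  then have "summable (\<lambda>n. sqrt_iter g (Suc n) - sqrt_iter g n)"
    by (rule summable_comparison_test')
      (use norm_sqrt_iter_Suc_diff_le [OF assms(2)] in \<open>auto simp: \<sigma>_def\<close>)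
  then have "convergent (\<lambda>n. \<Sum>k<n. sqrt_iter g (Suc k) - sqrt_iter g k)"
    by (simp add: summable_iff_convergent)
  then have "convergent (sqrt_iter g)"
    by (simp add: sum_lessThan_telescope del: sqrt_iter.simps(2))
  then obtain s where s: "sqrt_iter g \<longlonglongrightarrow> s"
    by (auto simp: convergent_def)
  have "cstar (sqrt_iter g n) = sqrt_iter g n" for n
    by (induction n) (simp_all add: cstar_scaleR cstar_add cstar_mult assms)
  then have 1: "cstar s = s"
    using bounded_linear.tendsto [OF bounded_linear_cstar s] s by (simp add: LIMSEQ_unique)
  have "norm (sqrt_iter g n) \<le> 1" for n
    using norm_sqrt_iter_le [OF assms(2)] sqrt_iter_real_bounds order_trans by blast
  then have 2: "norm s \<le> 1"
    using s by (intro LIMSEQ_le_const2 [OF tendsto_norm]) auto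
  have "(\<lambda>n. sqrt_iter g (Suc n)) \<longlonglongrightarrow> (1/2) *\<^sub>R (g + s * s)"
    unfolding sqrt_iter.simps by (intro tendsto_intros s)
  then have "s = (1/2) *\<^sub>R (g + s * s)"
    using s LIMSEQ_Suc LIMSEQ_unique by blast
  then have "2 *\<^sub>R s = 2 *\<^sub>R ((1/2) *\<^sub>R (g + s * s))"
    by (rule arg_cong)
  then have 3: "s + s = g + s * s"
    by (simp add: scaleR_2)
  have 4: "c * s = s * c" if "c * g = g * c" for c
  proof -
    have "(\<lambda>n. c * sqrt_iter g n) \<longlonglongrightarrow> c * s" "(\<lambda>n. c * sqrt_iter g n) \<longlonglongrightarrow> s * c"
      by (intro tendsto_intros s) (simp add: sqrt_iter_commute [OF that], intro tendsto_intros s)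
    then show ?thesis
      by (rule LIMSEQ_unique)
  qed
  show thesis
    using that 1 2 3 4 by blast
qed

subsection \<open>Positive elements of unital algebras\<close>

text \<open>For self-adjoint \<open>h\<close>, having its spectrum in \<open>[0, 2t]\<close> means exactly
  \<open>\<parallel>t - h\<parallel> \<le> t\<close>. In this form the sum of two positive elements is visibly positive.\<close>
definition norm_pos :: "'a::{cstar_algebra,real_normed_algebra_1} \<Rightarrow> bool" where
  "norm_pos h \<longleftrightarrow> cstar h = h \<and> (\<exists>t. norm (t *\<^sub>R 1 - h) \<le> t)"

lemma cstar_one [simp]: "cstar 1 = (1::'a::{cstar_algebra,real_normed_algebra_1})"
  by (metis cstar_cstar cstar_mult mult_1_left mult_1_right)

lemma norm_pos_cstar: "norm_pos h \<Longrightarrow> cstar h = h"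
  by (simp add: norm_pos_def)

text \<open>Raising \<open>t\<close> by some amount raises the norm by at most that amount. Hence
  \<open>t\<close> may be chosen as large as convenient.\<close>

lemma norm_posE:
  assumes "norm_pos h"
  obtains T where "\<And>t. t \<ge> T \<Longrightarrow> norm (t *\<^sub>R 1 - h) \<le> t"
proof -
  obtain T where T: "norm (T *\<^sub>R 1 - h) \<le> T"
    using assms by (auto simp: norm_pos_def)
  have "norm (t *\<^sub>R 1 - h) \<le> t" if "t \<ge> T" for t
  proof -
    have "norm ((t - T) *\<^sub>R (1::'a) + (T *\<^sub>R 1 - h)) \<le> norm ((t - T) *\<^sub>R (1::'a)) + norm (T *\<^sub>R 1 - h)"
      by (rule norm_triangle_ineq)
    also have "\<dots> \<le> (t - T) + T"
      using that T by simp
    finally show ?thesis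
      by (simp add: scaleR_left_diff_distrib)
  qed
  then show thesis
    using that by blast
qed

section \<open>The cone of positive elements\<close>

lemma norm_pos_add:
  assumes "norm_pos h" "norm_pos k"
  shows "norm_pos (h + k)"
proof -
  obtain s t where "norm (s *\<^sub>R 1 - h) \<le> s" "norm (t *\<^sub>R 1 - k) \<le> t"
    using assms by (auto simp: norm_pos_def)
  then have "norm ((s *\<^sub>R 1 - h) + (t *\<^sub>R 1 - k)) \<le> s + t"
    by (meson add_mono norm_triangle_le)
  moreover have "(s *\<^sub>R 1 - h) + (t *\<^sub>R 1 - k) = (s + t) *\<^sub>R 1 - (h + k)"
    by (simp add: scaleR_left_distrib)
  ultimately show ?thesis
    using assms by (auto simp: norm_pos_def cstar_add)
qed

lemma norm_pos_scaleR:
  assumes "norm_pos h" "r \<ge> 0"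
  shows "norm_pos (r *\<^sub>R h)"
proof -
  obtain t where t: "norm (t *\<^sub>R 1 - h) \<le> t"
    using assms by (auto simp: norm_pos_def)
  have "(r * t) *\<^sub>R 1 - r *\<^sub>R h = r *\<^sub>R (t *\<^sub>R 1 - h)"
    by (simp add: scaleR_right_diff_distrib)
  then have "norm ((r * t) *\<^sub>R 1 - r *\<^sub>R h) \<le> r * t"
    using t assms by (simp add: mult_left_mono)
  then show ?thesis
    using assms by (auto simp: norm_pos_def cstar_scaleR)
qed

lemma norm_pos_diff:
  assumes "cstar h = h" "norm h \<le> t"
  shows "norm_pos (t *\<^sub>R 1 - h)"
proof -
  have "norm (t *\<^sub>R 1 - (t *\<^sub>R 1 - h)) \<le> t"
    using assms by simp
  then show ?thesis
    unfolding norm_pos_def using assms by (intro conjI exI [of _ t]) (simp_all add: cstar_diff cstar_scaleR)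
qed

lemma norm_pos_scaleR_one: "r \<ge> 0 \<Longrightarrow> norm_pos (r *\<^sub>R 1)"
  using norm_pos_diff [of 0 r] by simp

text \<open>Rescaling to \<open>h = t (1 - g)\<close> with \<open>norm g \<le> 1\<close> gives the
  root \<open>sqrt t (1 - s)\<close>, positive because \<open>norm s \<le> 1\<close>. The
  commutation clause lets roots of commuting elements commute.\<close>

lemma norm_pos_sqrt:
  assumes "norm_pos h"
  obtains r where "norm_pos r" "r * r = h" "\<And>c. c * h = h * c \<Longrightarrow> c * r = r * c"
proof -
  obtain T where T: "\<And>t. t \<ge> T \<Longrightarrow> norm (t *\<^sub>R 1 - h) \<le> t"
    using norm_posE [OF assms] by blast
  \<comment> \<open>The maximum makes \<open>t\<close> positive, so that one may divide by
    it.\<close>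
  define t where "t = max T 1"
  have t: "t > 0" "norm (t *\<^sub>R 1 - h) \<le> t"
    using T by (auto simp: t_def)
  define g where "g = 1 - (1/t) *\<^sub>R h"
  have h: "h = t *\<^sub>R (1 - g)"
    using t by (simp add: g_def)
  have "t *\<^sub>R 1 - h = t *\<^sub>R g"
    by (simp add: h scaleR_right_diff_distrib)
  then have "norm g \<le> 1"
    using t by simp
  moreover have "cstar g = g"
    using assms by (simp add: g_def cstar_diff cstar_scaleR norm_pos_cstar)
  ultimately obtain s where s: "cstar s = s" "norm s \<le> 1" "s + s = g + s * s"
    "\<And>c. c * g = g * c \<Longrightarrow> c * s = s * c"
    using sqrt_one_minus_exists by blast
  have np: "norm_pos (1 - s)"
    using norm_pos_diff [OF s(1,2)] by simp
  have "(1 - s) * (1 - s) = 1 - g"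
    using s(3) by (simp add: algebra_simps)
  then have "(sqrt t *\<^sub>R (1 - s)) * (sqrt t *\<^sub>R (1 - s)) = h"
    using t by (simp add: h)
  moreover have "c * (sqrt t *\<^sub>R (1 - s)) = sqrt t *\<^sub>R (1 - s) * c" if "c * h = h * c" for c
    using s(4) [of c] that by (simp add: g_def algebra_simps)
  moreover have "norm_pos (sqrt t *\<^sub>R (1 - s))"
    using np t by (intro norm_pos_scaleR) auto
  ultimately show thesis
    using that by blast
qed

text \<open>With \<open>t = norm (h * h)\<close>, the root \<open>k\<close> of
  \<open>t - h^2\<close> commutes with \<open>h\<close>, and
  \<open>norm k ^ 2 \<le> norm (k^2 + h^2) = t\<close>. Since \<open>k^2 = t - h^2\<close>, this is
  the required bound.\<close>

lemma norm_pos_square: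
  assumes "cstar h = h"
  shows "norm_pos (h * h)"
proof -
  define t where "t = norm (h * h)"
  have sa: "cstar (h * h) = h * h"
    by (simp add: cstar_mult assms)
  have "norm_pos (t *\<^sub>R 1 - h * h)"
    using sa by (intro norm_pos_diff) (simp_all add: t_def)
  then obtain k where k: "norm_pos k" "k * k = t *\<^sub>R 1 - h * h"
    "\<And>c. c * (t *\<^sub>R 1 - h * h) = (t *\<^sub>R 1 - h * h) * c \<Longrightarrow> c * k = k * c"
    using norm_pos_sqrt by blast
  have "h * k = k * h"
    by (rule k) (simp add: algebra_simps)
  then have "norm k * norm k \<le> norm (k * k + h * h)"
    by (intro norm_le_norm_sum_squares) (auto simp: assms norm_pos_cstar k(1))
  then have "norm (k * k) \<le> t"
    using k(1,2) norm_square_selfadjoint [of k] by (simp add: t_def norm_pos_cstar)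
  then show ?thesis
    using sa k(2) by (auto simp: norm_pos_def)
qed

text \<open>The roots \<open>a\<close> and \<open>b\<close> of the factors commute, so the product
  is the square of the self-adjoint element \<open>a * b\<close>.\<close>

lemma norm_pos_mult:
  assumes "norm_pos h" "norm_pos k" "h * k = k * h"
  shows "norm_pos (h * k)"
proof -
  obtain a where a: "norm_pos a" "a * a = h" "\<And>c. c * h = h * c \<Longrightarrow> c * a = a * c"
    using norm_pos_sqrt [OF assms(1)] by metis
  obtain b where b: "norm_pos b" "b * b = k" "\<And>c. c * k = k * c \<Longrightarrow> c * b = b * c"
    using norm_pos_sqrt [OF assms(2)] by metis
  have "k * a = a * k"
    using a(3) assms(3) by simp
  then have ab: "a * b = b * a"
    using b(3) by simp
  then have "(a * b) * (a * b) = h * k"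
    by (metis a(2) b(2) mult.assoc)
  moreover have "cstar (a * b) = a * b"
    using ab a(1) b(1) by (simp add: cstar_mult norm_pos_cstar)
  ultimately show ?thesis
    using norm_pos_square by metis
qed

text \<open>Commuting roots of \<open>h\<close> and \<open>- h\<close> have squares that sum to
  zero, which forces the first root to vanish.\<close>

lemma norm_pos_antisym:
  assumes "norm_pos h" "norm_pos (- h)"
  shows "h = 0"
proof -
  obtain a where a: "norm_pos a" "a * a = h" "\<And>c. c * h = h * c \<Longrightarrow> c * a = a * c"
    using norm_pos_sqrt [OF assms(1)] by metis
  obtain b where b: "norm_pos b" "b * b = - h" "\<And>c. c * (- h) = (- h) * c \<Longrightarrow> c * b = b * c"
    using norm_pos_sqrt [OF assms(2)] by metis
  have "a * h = h * a"
    using a(2) by (metis mult.assoc)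
  then have "a * b = b * a"
    using b(3) by simp
  then have "norm a * norm a \<le> norm (a * a + b * b)"
    by (intro norm_le_norm_sum_squares) (auto simp: norm_pos_cstar a(1) b(1))
  then have "a = 0"
    by (simp add: a(2) b(2) mult_le_0_iff)
  then show ?thesis
    using a(2) by simp
qed

text \<open>Here \<open>s^2 - a^2 = (s - a) (s + a)\<close> is a product of commuting positive
  elements. Its root \<open>k\<close> gives
  \<open>norm a ^ 2 \<le> norm (a^2 + k^2) = s^2\<close>.\<close>

lemma norm_le_if_norm_pos:
  assumes "norm_pos a" "norm_pos (s *\<^sub>R 1 - a)" "s \<ge> 0"
  shows "norm a \<le> s"
proof -
  have "norm_pos (s *\<^sub>R 1 + a)"
    using assms by (intro norm_pos_add norm_pos_scaleR_one)
  then have "norm_pos ((s *\<^sub>R 1 - a) * (s *\<^sub>R 1 + a))"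
    using assms by (intro norm_pos_mult) (auto simp: algebra_simps)
  moreover have e: "(s *\<^sub>R 1 - a) * (s *\<^sub>R 1 + a) = (s * s) *\<^sub>R 1 - a * a"
    by (simp add: algebra_simps)
  ultimately obtain k where k: "norm_pos k" "k * k = (s * s) *\<^sub>R 1 - a * a"
      "\<And>c. c * ((s * s) *\<^sub>R 1 - a * a) = ((s * s) *\<^sub>R 1 - a * a) * c \<Longrightarrow> c * k = k * c"
    using norm_pos_sqrt by (metis (no_types))
  have "a * k = k * a"
    by (rule k) (simp add: algebra_simps)
  then have "norm a * norm a \<le> norm (a * a + k * k)"
    using assms by (intro norm_le_norm_sum_squares) (auto simp: norm_pos_cstar k(1))
  then have "norm a * norm a \<le> s * s"
    using assms by (simp add: k(2))
  then show ?thesis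
    using assms(3) by (metis abs_le_square_iff abs_of_nonneg norm_ge_zero power2_eq_square)
qed

lemma norm_mono_if_norm_pos:
  assumes "norm_pos a" "norm_pos (b - a)"
  shows "norm a \<le> norm b"
proof (rule norm_le_if_norm_pos)
  have "norm_pos b"
    using norm_pos_add [OF assms] by simp
  then have "norm_pos (norm b *\<^sub>R 1 - b)"
    by (intro norm_pos_diff) (auto simp: norm_pos_cstar)
  from norm_pos_add [OF this assms(2)] show "norm_pos (norm b *\<^sub>R 1 - a)"
    by simp
qed (use assms in auto)

text \<open>The witness is \<open>t = norm h\<close>: both \<open>norm h - h\<close> and
  \<open>(norm h + e) - (norm h - h) = h + e\<close> are positive, which bounds the norm of
  \<open>norm h - h\<close> by \<open>norm h + e\<close> for every \<open>e > 0\<close>.\<close>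

lemma norm_pos_limit:
  assumes "\<And>e. e > 0 \<Longrightarrow> norm_pos (h + e *\<^sub>R 1)"
  shows "norm_pos h"
proof -
  have "cstar (h + 1) = h + 1"
    using assms [of 1] by (simp add: norm_pos_cstar)
  then have sa: "cstar h = h"
    by (simp add: cstar_add)
  have *: "norm (norm h *\<^sub>R 1 - h) \<le> norm h + e" if "e > 0" for e
  proof -
    define t where "t = norm h + e"
    have "norm_pos (t *\<^sub>R 1 - (norm h *\<^sub>R 1 - h))"
      using assms [OF that] by (simp add: t_def algebra_simps)
    moreover have "norm_pos (norm h *\<^sub>R 1 - h)"
      using sa by (intro norm_pos_diff) auto
    ultimately show ?thesis
      using norm_le_if_norm_pos [of "norm h *\<^sub>R 1 - h" t] that by (simp add: t_def)
  qed
  have "norm (norm h *\<^sub>R 1 - h) \<le> norm h"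
    by (rule field_le_epsilon) (use * in auto)
  then show ?thesis
    using sa by (auto simp: norm_pos_def)
qed

text \<open>The relation \<open>(t - d d\<^sup>*) d = d (t + p)\<close> bounds \<open>d (t + p)\<close> by \<open>t \<parallel>d\<parallel>\<close>, which is
  impossible for positive \<open>p\<close> unless it vanishes.\<close>
lemma star_mult_self_neg_eq_0:
  assumes q: "norm_pos (d * cstar d)" and p: "norm_pos p" and dp: "cstar d * d = - p"
  shows "p = 0"
proof -
  obtain T where T: "\<And>t. t \<ge> T \<Longrightarrow> norm (t *\<^sub>R 1 - d * cstar d) \<le> t"
    using norm_posE [OF q] by blast
  define t where "t = max T 1"
  have t: "t > 0" "norm (t *\<^sub>R 1 - d * cstar d) \<le> t"
    using T by (auto simp: t_def)
  define N where "N = norm p"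
  have N: "N \<ge> 0" "norm d * norm d = N"
    by (simp_all add: N_def dp flip: cstar_identity)
  note sa = norm_pos_cstar [OF p]
  define y where "y = d * (t *\<^sub>R 1 + p)"
  have "y = (t *\<^sub>R 1 - d * cstar d) * d"
    using dp by (simp add: y_def algebra_simps mult.assoc)
  then have "norm y \<le> t * norm d"
    using t by (metis mult_right_mono norm_ge_zero norm_mult_ineq order_trans)
  then have "norm y * norm y \<le> (t * norm d) * (t * norm d)"
    using t by (intro mult_mono) auto
  also have "\<dots> = t * t * N"
    by (simp flip: N(2))
  finally have "norm (cstar y * y) \<le> t * t * N"
    by (simp add: cstar_identity)
  moreover have yy: "cstar y * y = - ((t *\<^sub>R 1 + p) * p * (t *\<^sub>R 1 + p))"
  proof -
    have "cstar y * y = (t *\<^sub>R 1 + p) * (cstar d * d) * (t *\<^sub>R 1 + p)"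
      by (simp add: y_def cstar_mult cstar_add cstar_scaleR sa mult.assoc)
    then show ?thesis
      by (simp add: dp)
  qed
  ultimately have "norm ((t *\<^sub>R 1 + p) * p * (t *\<^sub>R 1 + p)) \<le> t * t * N"
    by simp
  then have x1: "norm_pos ((t * t * N) *\<^sub>R 1 - (t *\<^sub>R 1 + p) * p * (t *\<^sub>R 1 + p))"
    by (intro norm_pos_diff) (auto simp: cstar_mult cstar_add cstar_scaleR sa mult.assoc)
  have pp: "norm_pos (p * p)"
    using norm_pos_mult [OF p p] by simp
  then have ppp: "norm_pos (p * p * p)"
    using norm_pos_mult [OF _ p] by (simp add: mult.assoc)
  \<comment> \<open>Adding the positive cube of \<open>p\<close> removes the cubic term of
    \<open>(t + p) p (t + p)\<close>.\<close>
  have x3: "norm_pos ((t * t * N) *\<^sub>R 1 - (t * t) *\<^sub>R p - (2 * t) *\<^sub>R (p * p))"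
  proof -
    have eq: "((t * t * N) *\<^sub>R 1 - (t *\<^sub>R 1 + p) * p * (t *\<^sub>R 1 + p)) + p * p * p
      = (t * t * N) *\<^sub>R 1 - (t * t) *\<^sub>R p - (2 * t) *\<^sub>R (p * p)"
      by (simp add: algebra_simps scaleR_2 flip: scaleR_scaleR)
    show ?thesis
      using norm_pos_add [OF x1 ppp] unfolding eq .
  qed
  \<comment> \<open>Adding \<open>t^2\<close> times this element to \<open>N\<close> times the one
    in \<open>x3\<close> cancels the terms linear in \<open>p\<close> and bounds
    \<open>(t^2 + 2 t N) p^2\<close> by \<open>t^2 N^2\<close>. As \<open>N = norm p\<close>, this
    forces \<open>N = 0\<close>.\<close>
  have "norm_pos (p * (N *\<^sub>R 1 - p))"
    using norm_pos_diff [OF sa, of N] by (intro norm_pos_mult p) (auto simp: N_def algebra_simps)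
  then have "norm_pos (N *\<^sub>R ((t * t * N) *\<^sub>R 1 - (t * t) *\<^sub>R p - (2 * t) *\<^sub>R (p * p))
      + (t * t) *\<^sub>R (p * (N *\<^sub>R 1 - p)))"
    using t N x3 by (intro norm_pos_add norm_pos_scaleR) auto
  also have "(N *\<^sub>R ((t * t * N) *\<^sub>R 1 - (t * t) *\<^sub>R p - (2 * t) *\<^sub>R (p * p))
      + (t * t) *\<^sub>R (p * (N *\<^sub>R 1 - p))) = (t * t * N * N) *\<^sub>R 1 - (t * t + 2 * t * N) *\<^sub>R (p * p)"
    by (simp add: algebra_simps)
  finally have "norm ((t * t + 2 * t * N) *\<^sub>R (p * p)) \<le> t * t * N * N"
    using t N pp by (intro norm_le_if_norm_pos norm_pos_scaleR) auto
  moreover have "norm ((t * t + 2 * t * N) *\<^sub>R (p * p)) = (t * t + 2 * t * N) * (N * N)"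
    using t N by (simp add: N_def norm_square_selfadjoint sa)
  ultimately have "2 * t * N * (N * N) \<le> 0"
    by (simp add: algebra_simps)
  then have "N = 0"
    using t N by (auto simp: mult_le_0_iff)
  then show ?thesis
    by (simp add: N_def)
qed

text \<open>The root \<open>r\<close> of \<open>c^2\<close> plays the role of the absolute value of
  \<open>c\<close>, and \<open>m = r - c\<close> is twice its negative part. Then
  \<open>d = b * m\<close> has \<open>cstar d * d = - p\<close> with \<open>p\<close> positive,
  which makes \<open>d * cstar d\<close> positive as well; so \<open>p\<close> and hence
  \<open>m\<close> vanish, and \<open>c = r\<close>.\<close>

lemma norm_pos_star_mult_self: "norm_pos (cstar b * b)"
proof -
  define c where "c = cstar b * b"
  have c: "cstar c = c"
    by (simp add: c_def cstar_mult cstar_cstar)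
  obtain r where r: "norm_pos r" "r * r = c * c" "\<And>x. x * (c * c) = (c * c) * x \<Longrightarrow> x * r = r * x"
    using norm_pos_sqrt [OF norm_pos_square [OF c]] by metis
  have cr: "c * r = r * c"
    by (rule r) (simp add: mult.assoc)
  define m where "m = r - c"
  have m: "cstar m = m"
    by (simp add: m_def cstar_diff c r(1) norm_pos_cstar)
  have mr: "m * r = r * m" and mc: "m * c = c * m"
    by (simp_all add: m_def algebra_simps cr)
  have mm: "2 *\<^sub>R (m * r) = m * m" "2 *\<^sub>R (m * c) = - (m * m)"
    by (simp_all add: m_def algebra_simps cr r(2) scaleR_2)
  have m3: "norm_pos (m * m * m)"
  proof -
    have "(m * m) * r = r * (m * m)"
      by (metis mr mult.assoc)
    then have "norm_pos ((m * m) * r)"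
      by (rule norm_pos_mult [OF norm_pos_square [OF m] r(1)])
    then have "norm_pos (2 *\<^sub>R ((m * m) * r))"
      by (rule norm_pos_scaleR) simp
    also have "2 *\<^sub>R ((m * m) * r) = m * m * m"
      by (metis mm(1) mult.assoc mult_scaleR_right)
    finally show ?thesis .
  qed
  define d where "d = b * m"
  define p where "p = (1/2) *\<^sub>R (m * m * m)"
  have p: "norm_pos p"
    unfolding p_def using m3 by (rule norm_pos_scaleR) simp
  have dd: "cstar d * d = - p"
  proof -
    have "cstar d * d = m * c * m"
      by (simp add: d_def c_def cstar_mult m mult.assoc)
    then have "2 *\<^sub>R (cstar d * d) = (2 *\<^sub>R (m * c)) * m"
      by simp
    also have "\<dots> = 2 *\<^sub>R (- p)"
      by (simp only: mm) (simp add: p_def)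
    finally show ?thesis
      by (metis scaleR_cancel_left zero_neq_numeral)
  qed
  \<comment> \<open>Up to sign, \<open>e\<close> and \<open>f\<close> are twice the real and
    imaginary parts of \<open>d\<close>; their squares sum to
    \<open>2 (d * cstar d + cstar d * d)\<close>.\<close>
  define e f where "e = d + cstar d" and "f = \<i> *\<^sub>C (d - cstar d)"
  have ef: "cstar e = e" "cstar f = f"
    by (simp_all add: e_def f_def cstar_add cstar_cstar cstar_diff cstar_cscale cscale_minus_left
        cscale_diff_right)
  have "f * f = - ((d - cstar d) * (d - cstar d))"
    by (simp add: f_def mult_cscale_left mult_cscale_right cscale_cscale cscale_minus_left cscale_one)
  then have "e * e + f * f = 2 *\<^sub>R (d * cstar d + cstar d * d)"
    by (simp add: e_def algebra_simps scaleR_2)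
  then have "norm_pos (2 *\<^sub>R (d * cstar d + cstar d * d))"
    by (metis ef norm_pos_add norm_pos_square)
  then have "norm_pos ((1/2) *\<^sub>R (2 *\<^sub>R (d * cstar d + cstar d * d)))"
    by (rule norm_pos_scaleR) simp
  then have "norm_pos (d * cstar d - p)"
    by (simp add: dd)
  from norm_pos_add [OF this p] have "norm_pos (d * cstar d)"
    by simp
  then have "p = 0"
    using p dd star_mult_self_neg_eq_0 by blast
  \<comment> \<open>The fourth power is a star square of \<open>m * m\<close>, so the C*-identity
    applies twice in succession.\<close>
  then have "m * m * m * m = 0"
    by (simp add: p_def)
  then have "cstar (m * m) * (m * m) = 0"
    by (simp add: cstar_mult m mult.assoc)
  then have "m * m = 0"
    by (rule cstar_mult_self_eq_0)
  then have "m = 0"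
    by (metis cstar_mult_self_eq_0 m)
  then show ?thesis
    using r(1) by (simp add: m_def c_def)
qed

lemma norm_pos_congruence:
  assumes "norm_pos a"
  shows "norm_pos (cstar c * a * c)"
proof -
  obtain r where "norm_pos r" "r * r = a"
    using norm_pos_sqrt [OF assms] by metis
  then have "cstar c * a * c = cstar (r * c) * (r * c)"
    by (simp add: cstar_mult norm_pos_cstar mult.assoc flip: \<open>r * r = a\<close>)
  then show ?thesis
    by (simp add: norm_pos_star_mult_self)
qed

lemma norm_pos_sqrt_unique:
  assumes "norm_pos a" "norm_pos b" "a * a = b * b"
  shows "a = b"
proof -
  \<comment> \<open>\<open>a\<close> and \<open>b\<close> are not known to commute, so each is
    compared with a root \<open>r\<close> that commutes with everything commuting with their common
    square.\<close>
  have unique: "x = r" if x: "norm_pos x" and r: "norm_pos r" "r * r = x * x"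
      "\<And>c. c * (x * x) = (x * x) * c \<Longrightarrow> c * r = r * c" for x r :: 'a
  proof -
    have xr: "x * r = r * x"
      by (rule r) (simp add: mult.assoc)
    define z where "z = x - r"
    have z: "cstar z = z"
      by (simp add: z_def cstar_diff norm_pos_cstar x r(1))
    have zx: "z * x = x * z" and zr: "z * r = r * z"
      by (simp_all add: z_def algebra_simps xr)
    have "z * (x + r) = 0"
      by (simp add: z_def algebra_simps xr r(2))
    \<comment> \<open>Both summands are positive and they are opposite, hence both vanish; their
      difference is the cube of \<open>z\<close>.\<close>
    then have "z * z * x + z * z * r = 0"
      by (metis distrib_left mult.assoc mult_zero_right)
    then have "z * z * x = - (z * z * r)"
      by (simp add: eq_neg_iff_add_eq_0)
    moreover have "(z * z) * x = x * (z * z)" "(z * z) * r = r * (z * z)"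
      by (metis zx mult.assoc, metis zr mult.assoc)
    then have "norm_pos (z * z * x)" "norm_pos (z * z * r)"
      using norm_pos_mult norm_pos_square z x r(1) by blast+
    ultimately have "z * z * x = 0" "z * z * r = 0"
      using norm_pos_antisym by (metis neg_equal_0_iff_equal)+
    then have "z * z * z = 0"
      by (simp add: z_def right_diff_distrib)
    then have "cstar (z * z) * (z * z) = 0"
      by (simp add: cstar_mult z flip: mult.assoc)
    then have "z * z = 0"
      by (rule cstar_mult_self_eq_0)
    then have "z = 0"
      by (metis cstar_mult_self_eq_0 z)
    then show ?thesis
      by (simp add: z_def)
  qed
  obtain r where "norm_pos r" "r * r = a * a" "\<And>c. c * (a * a) = (a * a) * c \<Longrightarrow> c * r = r * c"
    using norm_pos_sqrt norm_pos_square norm_pos_cstar assms(1) by (metis (no_types))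
  then show ?thesis
    using unique assms by metis
qed

text \<open>Writing \<open>b + e = (t + e) (1 - g)\<close> with
  \<open>norm g \<le> t / (t + e) < 1\<close> makes the Neumann series of \<open>g\<close>
  available.\<close>

lemma inverse_add_scaleR_exists:
  assumes "norm_pos b" "e > 0"
  obtains y where "cstar y = y" "y * (b + e *\<^sub>R 1) = 1" "(b + e *\<^sub>R 1) * y = 1"
proof -
  obtain T where T: "\<And>t. t \<ge> T \<Longrightarrow> norm (t *\<^sub>R 1 - b) \<le> t"
    using norm_posE [OF assms(1)] by blast
  define t where "t = max T 1"
  have t: "t > 0" "norm (t *\<^sub>R 1 - b) \<le> t"
    using T by (auto simp: t_def)
  define g where "g = (1 / (t + e)) *\<^sub>R (t *\<^sub>R 1 - b)"
  have "norm g = norm (t *\<^sub>R 1 - b) / (t + e)"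
    using t assms by (simp add: g_def)
  then have "norm g < 1"
    using t assms by simp
  then have sm: "summable (\<lambda>n. g ^ n)"
    by (rule complete_algebra_summable_geometric)
  define S where "S = (\<Sum>n. g ^ n)"
  have split: "(\<Sum>n. g ^ Suc n) = S - 1"
    using suminf_split_head [OF sm] by (simp add: S_def)
  have gS: "g * S = S - 1"
    using suminf_mult [OF sm, of g] split by (simp add: S_def)
  have Sg: "S * g = S - 1"
    using suminf_mult2 [OF sm, of g] split by (simp add: S_def power_Suc2 del: power_Suc)
  have b: "b + e *\<^sub>R 1 = (t + e) *\<^sub>R (1 - g)"
  proof -
    have "(t + e) *\<^sub>R g = t *\<^sub>R 1 - b"
      using t assms by (simp add: g_def)
    then show ?thesis
      by (simp add: scaleR_right_diff_distrib scaleR_left_distrib)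
  qed
  define y where "y = (1 / (t + e)) *\<^sub>R S"
  have y: "y * (b + e *\<^sub>R 1) = 1" "(b + e *\<^sub>R 1) * y = 1"
    using t assms unfolding b y_def
    by (simp_all add: left_diff_distrib right_diff_distrib gS Sg flip: scaleR_right_diff_distrib)
  have "cstar (b + e *\<^sub>R 1) * cstar y = 1"
    using y(1) by (metis cstar_mult cstar_one)
  then have "(b + e *\<^sub>R 1) * cstar y = 1"
    by (simp add: cstar_add cstar_scaleR norm_pos_cstar assms)
  \<comment> \<open>A left inverse and a right inverse of the same element coincide.\<close>
  then have "cstar y = y"
    by (metis y(1) mult.assoc mult_1_left mult_1_right)
  then show thesis
    using that y by blast
qed

section \<open>Spectral radius and monotonicity of the square root\<close>

lemma norm_pow2_selfadjoint:
  fixes w :: "'a::{cstar_algebra,real_normed_algebra_1}"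
  assumes "cstar w = w"
  shows "norm (w ^ 2 ^ k) = norm w ^ 2 ^ k"
proof (induction k)
  case (Suc k)
  have "cstar (w ^ n) = w ^ n" for n
    by (induction n) (simp_all add: assms cstar_mult power_commutes)
  then have "norm (w ^ 2 ^ k * w ^ 2 ^ k) = norm (w ^ 2 ^ k) * norm (w ^ 2 ^ k)"
    by (rule norm_square_selfadjoint)
  then show ?case
    by (simp add: Suc mult_2 power_add)
qed simp

text \<open>A self-adjoint element attains its spectral radius as its norm, and the spectral radius is
  invariant under similarity.\<close>
lemma norm_le_1_if_similar_contraction:
  fixes v w :: "'a::{cstar_algebra,real_normed_algebra_1}"
  assumes "cstar w = w" "norm v \<le> 1" "w = s * v * r" "r * s = 1"
  shows "norm w \<le> 1"
proof (rule ccontr)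
  assume w: "\<not> norm w \<le> 1"
  \<comment> \<open>The inner factors \<open>r * s\<close> cancel in every power.\<close>
  have pow: "w ^ Suc n = s * v ^ Suc n * r" for n
  proof (induction n)
    case (Suc n)
    have "w ^ Suc (Suc n) = s * v ^ Suc n * (r * s) * v * r"
      by (simp only: power_Suc2 [of w "Suc n"] Suc) (simp add: assms(3) mult.assoc)
    then show ?case
      by (simp only: assms(4) power_Suc2 [of v "Suc n"]) (simp add: mult.assoc)
  qed (simp add: assms(3))
  have bound: "norm (w ^ n) \<le> norm s * norm r" if "n > 0" for n
  proof -
    have "w ^ n = s * v ^ n * r"
      using pow [of "n - 1"] that by simp
    then have "norm (w ^ n) \<le> norm s * norm (v ^ n) * norm r"
      by (metis mult_right_mono norm_ge_zero norm_mult_ineq order_trans)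
    also have "\<dots> \<le> norm s * 1 * norm r"
      using assms(2) by (intro mult_mono order_trans [OF norm_power_ineq] power_le_one) auto
    finally show ?thesis by simp
  qed
  obtain n where n: "norm s * norm r < norm w ^ n"
    using real_arch_pow w by (meson not_le)
  \<comment> \<open>Repeated use of the C*-identity evaluates the norm of a power exactly at
    exponents \<open>2 ^ n\<close>.\<close>
  have "norm w ^ n \<le> norm w ^ 2 ^ n"
    using w by (intro power_increasing) auto
  also have "\<dots> \<le> norm s * norm r"
    using bound [of "2 ^ n"] by (simp add: norm_pow2_selfadjoint assms(1))
  finally show False
    using n by simp
qed

text \<open>Replace \<open>b\<close> by the invertible \<open>\<beta> = b + e\<close>, with inverse
  \<open>y\<close>. From \<open>a^2 \<le> \<beta>^2\<close> one gets
  \<open>norm (a * y) \<le> 1\<close>. This element is similar to the self-adjoint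
  \<open>w = s * a * s\<close>, where \<open>s\<close> is the inverse of the root
  \<open>\<rho>\<close> of \<open>\<beta>\<close>; so \<open>w \<le> 1\<close>, and conjugating by
  \<open>\<rho>\<close> gives \<open>a \<le> \<beta>\<close>.\<close>

lemma norm_pos_sqrt_mono:
  assumes a: "norm_pos a" and b: "norm_pos b" and ab: "norm_pos (b * b - a * a)"
  shows "norm_pos (b - a)"
proof (rule norm_pos_limit)
  fix e :: real
  assume e: "e > 0"
  define \<beta> where "\<beta> = b + e *\<^sub>R 1"
  obtain y where y: "cstar y = y" "y * \<beta> = 1" "\<beta> * y = 1"
    using inverse_add_scaleR_exists [OF b e] unfolding \<beta>_def by metis
  have \<beta>: "norm_pos \<beta>"
    unfolding \<beta>_def using b e by (intro norm_pos_add norm_pos_scaleR_one) auto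
  obtain \<rho> where \<rho>: "norm_pos \<rho>" "\<rho> * \<rho> = \<beta>" "\<And>c. c * \<beta> = \<beta> * c \<Longrightarrow> c * \<rho> = \<rho> * c"
    using norm_pos_sqrt [OF \<beta>] by metis
  have y\<rho>: "y * \<rho> = \<rho> * y"
    using \<rho>(3) y by simp
  define s where "s = y * \<rho>"
  have s: "\<rho> * s = 1" "s * \<rho> = 1" "cstar s = s"
    using y \<rho>(1,2) y\<rho> by (simp_all add: s_def cstar_mult norm_pos_cstar mult.assoc)
      (simp_all flip: mult.assoc y\<rho>, simp_all add: mult.assoc)
  have "norm_pos (\<beta> * \<beta> - a * a)"
  proof -
    have "\<beta> * \<beta> - a * a = (b * b - a * a) + ((2 * e) *\<^sub>R b + (e * e) *\<^sub>R 1)"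
      by (simp add: \<beta>_def algebra_simps scaleR_2 flip: scaleR_scaleR)
    also have "norm_pos \<dots>"
      using a b ab e by (intro norm_pos_add norm_pos_scaleR norm_pos_scaleR_one) auto
    finally show ?thesis .
  qed
  then have "norm_pos (cstar y * (\<beta> * \<beta> - a * a) * y)"
    by (rule norm_pos_congruence)
  also have "cstar y * (\<beta> * \<beta> - a * a) * y = (y * \<beta>) * (\<beta> * y) - cstar (a * y) * (a * y)"
    using a by (simp add: y(1) cstar_mult norm_pos_cstar right_diff_distrib left_diff_distrib mult.assoc)
  finally have "norm_pos (1 *\<^sub>R 1 - cstar (a * y) * (a * y))"
    by (simp add: y)
  then have "norm (cstar (a * y) * (a * y)) \<le> 1"
    by (intro norm_le_if_norm_pos norm_pos_star_mult_self) auto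
  then have "norm (a * y) * norm (a * y) \<le> 1"
    by (simp add: cstar_identity)
  then have v: "norm (a * y) \<le> 1"
    by (meson le_less_trans less_1_mult not_le)
  define w where "w = s * a * s"
  have w: "cstar w = w"
    using a s by (simp add: w_def cstar_mult norm_pos_cstar mult.assoc)
  have "w = s * (a * y) * \<rho>"
    by (simp add: w_def s_def mult.assoc)
  then have "norm w \<le> 1"
    using norm_le_1_if_similar_contraction [OF w v] s by blast
  then have "norm_pos (1 *\<^sub>R 1 - w)"
    using w by (intro norm_pos_diff)
  then have "norm_pos (cstar \<rho> * (1 *\<^sub>R 1 - w) * \<rho>)"
    by (rule norm_pos_congruence)
  also have "cstar \<rho> * (1 *\<^sub>R 1 - w) * \<rho> = \<beta> - (\<rho> * s) * a * (s * \<rho>)"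
    by (simp add: norm_pos_cstar \<rho>(1,2) w_def right_diff_distrib left_diff_distrib mult.assoc)
  finally show "norm_pos (b - a + e *\<^sub>R 1)"
    by (simp add: s \<beta>_def algebra_simps)
qed

subsection \<open>Unitization\<close>

datatype 'a unitization = Adjoin (alg_part: 'a) (scal_part: complex)

lemmas cscale_simps = cscale_add_right cscale_add_left cscale_diff_right cscale_minus_left
  cscale_minus_right cscale_cscale cscale_one mult_cscale_left mult_cscale_right

instantiation unitization :: (cstar_algebra) "{real_algebra_1,cvector}"
begin

definition "0 = Adjoin 0 0"
definition "1 = Adjoin 0 1"
definition "z + w = Adjoin (alg_part z + alg_part w) (scal_part z + scal_part w)"
definition "z - w = Adjoin (alg_part z - alg_part w) (scal_part z - scal_part w)"
definition "- z = Adjoin (- alg_part z) (- scal_part z)"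
definition "r *\<^sub>R z = Adjoin (r *\<^sub>R alg_part z) (r *\<^sub>R scal_part z)"
definition "c *\<^sub>C z = Adjoin (c *\<^sub>C alg_part z) (c * scal_part z)"
definition "z * w = Adjoin
  (alg_part z * alg_part w + scal_part w *\<^sub>C alg_part z + scal_part z *\<^sub>C alg_part w)
  (scal_part z * scal_part w)"

lemmas unitization_defs = zero_unitization_def one_unitization_def plus_unitization_def
  minus_unitization_def uminus_unitization_def scaleR_unitization_def cscale_unitization_def
  times_unitization_def

instance
proof
  show "r *\<^sub>R z = complex_of_real r *\<^sub>C z" for r and z :: "'a unitization"
    by (simp add: unitization_defs scaleR_cscale scaleR_conv_of_real)
qed (auto simp: unitization_defs algebra_simps cscale_simps scaleR_cscale scaleR_conv_of_real)

end

lemma unitization_sel [simp]: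
  fixes z w :: "'a::cstar_algebra unitization"
  shows "alg_part 0 = (0::'a)" "scal_part (0::'a unitization) = 0"
    "alg_part 1 = (0::'a)" "scal_part (1::'a unitization) = 1"
    "alg_part (z + w) = alg_part z + alg_part w" "scal_part (z + w) = scal_part z + scal_part w"
    "alg_part (z - w) = alg_part z - alg_part w" "scal_part (z - w) = scal_part z - scal_part w"
    "alg_part (r *\<^sub>R z) = r *\<^sub>R alg_part z" "scal_part (r *\<^sub>R z) = r *\<^sub>R scal_part z"
    "alg_part (c *\<^sub>C z) = c *\<^sub>C alg_part z" "scal_part (c *\<^sub>C z) = c * scal_part z"
    "scal_part (z * w) = scal_part z * scal_part w"
  by (simp_all add: unitization_defs)

text \<open>Left multiplication on the original algebra, viewed as an ideal of its unitization; its
  operator norm enters the norm below.\<close>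

definition unitization_act :: "'a::cstar_algebra unitization \<Rightarrow> 'a \<Rightarrow> 'a" where
  "unitization_act z x = alg_part z * x + scal_part z *\<^sub>C x"

lemma unitization_act_simps:
  "unitization_act (z + w) x = unitization_act z x + unitization_act w x"
  "unitization_act (r *\<^sub>R z) x = r *\<^sub>R unitization_act z x"
  "unitization_act (c *\<^sub>C z) x = c *\<^sub>C unitization_act z x"
  "unitization_act (z * w) x = unitization_act z (unitization_act w x)"
  "unitization_act 1 x = x" "unitization_act 0 x = 0"
  by (simp_all add: unitization_act_def times_unitization_def algebra_simps cscale_simps
      scaleR_cscale mult.commute)

lemma norm_unitization_act_le:
  "norm (unitization_act z x) \<le> (norm (alg_part z) + cmod (scal_part z)) * norm x"
proof -
  have "norm (unitization_act z x) \<le> norm (alg_part z * x) + norm (scal_part z *\<^sub>C x)"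
    unfolding unitization_act_def by (rule norm_triangle_ineq)
  also have "\<dots> \<le> norm (alg_part z) * norm x + cmod (scal_part z) * norm x"
    by (intro add_mono norm_mult_ineq) (simp add: norm_cscale)
  finally show ?thesis
    by (simp add: distrib_right)
qed

lemma bounded_linear_unitization_act: "bounded_linear (unitization_act z)"
proof (rule bounded_linear_intro)
  show "norm (unitization_act z x) \<le> norm x * (norm (alg_part z) + cmod (scal_part z))" for x
    using norm_unitization_act_le [of z x] by (simp add: mult.commute)
qed (simp_all add: unitization_act_def algebra_simps cscale_simps scaleR_cscale mult.commute)

text \<open>The maximum with \<open>|\<lambda>|\<close> is needed when the algebra is already unital: the operator norm alone
  is then only a seminorm, since it vanishes at \<open>(e, -1)\<close> for the unit \<open>e\<close>.\<close>
instantiation unitization :: (cstar_algebra) real_normed_algebra_1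
begin

definition norm_unitization :: "'a unitization \<Rightarrow> real" where
  "norm z = max (cmod (scal_part z)) (onorm (unitization_act z))"
definition sgn_unitization :: "'a unitization \<Rightarrow> 'a unitization" where
  "sgn (z::'a unitization) = z /\<^sub>R norm z"
definition dist_unitization :: "'a unitization \<Rightarrow> 'a unitization \<Rightarrow> real" where
  "dist (z::'a unitization) w = norm (z - w)"
definition uniformity_unitization :: "('a unitization \<times> 'a unitization) filter" where
  "uniformity = (INF e\<in>{0<..}. principal {(z::'a unitization, w). dist z w < e})"
definition open_unitization :: "'a unitization set \<Rightarrow> bool" where
  "open (U::'a unitization set) \<longleftrightarrow> (\<forall>z\<in>U. eventually (\<lambda>(z', w). z' = z \<longrightarrow> w \<in> U) uniformity)"

instance
proof
  fix z w :: "'a unitization" and r :: real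
  note bl = bounded_linear_unitization_act
  show "norm z = 0 \<longleftrightarrow> z = 0"
  proof
    assume "norm z = 0"
    then have "cmod (scal_part z) \<le> 0" "onorm (unitization_act z) \<le> 0"
      by (auto simp: norm_unitization_def max_def split: if_splits)
    moreover from this have "onorm (unitization_act z) = 0"
      using onorm_pos_le [OF bl [of z]] by linarith
    ultimately have "scal_part z = 0" "unitization_act z x = 0" for x
      using onorm_eq_0 [OF bl] by auto
    \<comment> \<open>Evaluating at \<open>x = cstar (alg_part z)\<close> produces a star
      square.\<close>
    then have "scal_part z = 0" "cstar (cstar (alg_part z)) * cstar (alg_part z) = 0"
      by (simp_all add: unitization_act_def cstar_cstar)
    then have "scal_part z = 0" "cstar (cstar (alg_part z)) = 0"
      using cstar_mult_self_eq_0 by force+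
    then show "z = 0"
      by (simp add: cstar_cstar unitization.expand)
  qed (simp add: norm_unitization_def unitization_act_simps onorm_zero cong: onorm_def)
  show "norm (z + w) \<le> norm z + norm w"
  proof -
    have "onorm (unitization_act (z + w)) \<le> onorm (unitization_act z) + onorm (unitization_act w)"
      using onorm_triangle [OF bl [of z] bl [of w]] by (simp add: unitization_act_simps [abs_def])
    then show ?thesis
      using norm_triangle_ineq [of "scal_part z" "scal_part w"]
      unfolding norm_unitization_def unitization_sel by linarith
  qed
  show "norm (r *\<^sub>R z) = \<bar>r\<bar> * norm z"
    using onorm_scaleR [OF bl [of z], of r]
    by (simp add: norm_unitization_def unitization_act_simps [abs_def] max_mult_distrib_left)
  show "norm (z * w) \<le> norm z * norm w"
  proof -
    have "onorm (unitization_act (z * w)) \<le> onorm (unitization_act z) * onorm (unitization_act w)"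
      using onorm_compose [OF bl [of z] bl [of w]] by (simp add: unitization_act_simps [abs_def] o_def)
    also have "\<dots> \<le> norm z * norm w"
      by (intro mult_mono) (auto simp: norm_unitization_def onorm_pos_le bl le_max_iff_disj)
    finally have "onorm (unitization_act (z * w)) \<le> norm z * norm w" .
    moreover have "cmod (scal_part (z * w)) \<le> norm z * norm w"
      unfolding unitization_sel norm_mult
      by (intro mult_mono) (auto simp: norm_unitization_def le_max_iff_disj)
    ultimately show ?thesis
      by (simp add: norm_unitization_def [of "z * w"])
  qed
  show "norm (1::'a unitization) = 1"
    using onorm_id_le [where 'a = 'a]
    by (simp add: norm_unitization_def unitization_act_simps [abs_def])
qed (simp_all add: sgn_unitization_def dist_unitization_def uniformity_unitization_def
    open_unitization_def)

end

section \<open>Norm estimates and completeness of the unitization\<close>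

lemma cmod_scal_part_le: "cmod (scal_part z) \<le> norm (z::'a::cstar_algebra unitization)"
  by (simp add: norm_unitization_def)

lemma norm_act_le_norm: "norm (unitization_act z x) \<le> norm z * norm x"
  by (rule order_trans [OF onorm [OF bounded_linear_unitization_act]])
    (simp add: norm_unitization_def mult_right_mono)

lemma norm_unitization_le:
  "norm z \<le> norm (alg_part z) + cmod (scal_part (z::'a::cstar_algebra unitization))"
  by (simp add: norm_unitization_def onorm_bound norm_unitization_act_le)

text \<open>Letting \<open>z\<close> act on \<open>cstar a\<close> gives \<open>a * cstar a\<close>
  up to a scalar multiple of \<open>cstar a\<close>; each of the two terms costs one
  \<open>norm z\<close>.\<close>

lemma norm_alg_part_le: "norm (alg_part z) \<le> 2 * norm (z::'a::cstar_algebra unitization)"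
proof -
  define a where "a = alg_part z"
  have "a * cstar a = unitization_act z (cstar a) - scal_part z *\<^sub>C cstar a"
    by (simp add: unitization_act_def a_def)
  then have "norm (a * cstar a) \<le> norm (unitization_act z (cstar a)) + norm (scal_part z *\<^sub>C cstar a)"
    by (simp add: norm_triangle_ineq4)
  also have "\<dots> \<le> norm z * norm a + norm z * norm a"
    using norm_act_le_norm [of z "cstar a"] cmod_scal_part_le [of z]
    by (intro add_mono) (simp_all add: norm_cscale mult_right_mono)
  also have "norm (a * cstar a) = norm a * norm a"
    using cstar_identity [of "cstar a"] by (simp add: cstar_cstar)
  finally have "norm a * norm a \<le> (2 * norm z) * norm a"
    by (simp add: mult.commute)
  then show ?thesis
    unfolding a_def [symmetric] by (cases "a = 0") auto
qed

text \<open>The norm is equivalent to the sum of the norms of the two parts, so Cauchy sequences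
  converge componentwise.\<close>

instance unitization :: (cstar_algebra) banach
proof
  fix X :: "nat \<Rightarrow> 'a unitization"
  assume X: "Cauchy X"
  have "Cauchy (\<lambda>n. alg_part (X n))"
  proof (rule CauchyI)
    fix e :: real assume "e > 0"
    then obtain N where N: "\<And>m n. m \<ge> N \<Longrightarrow> n \<ge> N \<Longrightarrow> norm (X m - X n) < e / 2"
      using X by (meson CauchyD half_gt_zero)
    have "norm (alg_part (X m) - alg_part (X n)) < e" if "m \<ge> N" "n \<ge> N" for m n
      using norm_alg_part_le [of "X m - X n"] N [OF that] by simp
    then show "\<exists>N. \<forall>m\<ge>N. \<forall>n\<ge>N. norm (alg_part (X m) - alg_part (X n)) < e"
      by blast
  qed
  then obtain a where a: "(\<lambda>n. alg_part (X n)) \<longlonglongrightarrow> a"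
    using Cauchy_convergent by (auto simp: convergent_def)
  have "Cauchy (\<lambda>n. scal_part (X n))"
  proof (rule CauchyI)
    fix e :: real assume "e > 0"
    then obtain N where N: "\<And>m n. m \<ge> N \<Longrightarrow> n \<ge> N \<Longrightarrow> norm (X m - X n) < e"
      using X by (meson CauchyD)
    have "norm (scal_part (X m) - scal_part (X n)) < e" if "m \<ge> N" "n \<ge> N" for m n
      using cmod_scal_part_le [of "X m - X n"] N [OF that] by simp
    then show "\<exists>N. \<forall>m\<ge>N. \<forall>n\<ge>N. norm (scal_part (X m) - scal_part (X n)) < e"
      by blast
  qed
  then obtain l where l: "(\<lambda>n. scal_part (X n)) \<longlonglongrightarrow> l"
    using Cauchy_convergent by (auto simp: convergent_def)
  have "(\<lambda>n. norm (alg_part (X n) - a) + cmod (scal_part (X n) - l)) \<longlonglongrightarrow> 0"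
    using tendsto_add [OF tendsto_norm_zero [OF LIM_zero [OF a]] tendsto_norm_zero [OF LIM_zero [OF l]]]
    by simp
  then have "(\<lambda>n. X n - Adjoin a l) \<longlonglongrightarrow> 0"
  proof (rule Lim_null_comparison [rotated])
    show "\<forall>\<^sub>F n in sequentially.
        norm (X n - Adjoin a l) \<le> norm (alg_part (X n) - a) + cmod (scal_part (X n) - l)"
      using norm_unitization_le [of "X n - Adjoin a l" for n] by (intro always_eventually) simp
  qed
  then show "convergent X"
    using LIM_zero_cancel convergent_def by blast
qed

instantiation unitization :: (cstar_algebra) cstar_algebra
begin

definition cstar_unitization :: "'a unitization \<Rightarrow> 'a unitization" where
  "cstar z = Adjoin (cstar (alg_part z)) (cnj (scal_part z))"

instance
proof
  fix z w :: "'a unitization" and c :: complex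
  show *: "norm (c *\<^sub>C z) = cmod c * norm z" for c and z :: "'a unitization"
  proof -
    have le: "norm (c *\<^sub>C z) \<le> cmod c * norm z" for c and z :: "'a unitization"
    proof -
      have "onorm (unitization_act (c *\<^sub>C z)) \<le> cmod c * norm z"
        by (rule onorm_bound) (simp_all add: unitization_act_simps norm_cscale mult.assoc
            mult_left_mono norm_act_le_norm)
      then show ?thesis
        by (simp add: norm_unitization_def [of "c *\<^sub>C z"] norm_mult mult_left_mono cmod_scal_part_le)
    qed
    show ?thesis
    proof (cases "c = 0")
      case False
      have "norm z = norm (inverse c *\<^sub>C (c *\<^sub>C z))"
        using False by (simp add: cscale_cscale cscale_one)
      also have "\<dots> \<le> inverse (cmod c) * norm (c *\<^sub>C z)"
        using le [of "inverse c"] by (simp add: norm_inverse)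
      finally have "cmod c * norm z \<le> norm (c *\<^sub>C z)"
        using False by (simp add: field_simps)
      with le show ?thesis
        by (simp add: antisym)
    qed simp
  qed
  show "(c *\<^sub>C z) * w = c *\<^sub>C (z * w)" "z * (c *\<^sub>C w) = c *\<^sub>C (z * w)"
    by (simp_all add: unitization_defs algebra_simps cscale_simps)
  show "cstar (z + w) = cstar z + cstar w" "cstar (c *\<^sub>C z) = cnj c *\<^sub>C cstar z"
    by (simp_all add: unitization_defs cstar_unitization_def cstar_add cstar_cscale)
  show mult: "cstar (z * w) = cstar w * cstar z" for z w :: "'a unitization"
    by (simp add: unitization_defs cstar_unitization_def cstar_add cstar_cscale cstar_mult)
  show invol: "cstar (cstar z) = z" for z :: "'a unitization"
    by (simp add: cstar_unitization_def cstar_cstar)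
  \<comment> \<open>Left multiplications by \<open>u\<close> and \<open>cstar u\<close> are adjoint
    for the form \<open>cstar x * y\<close>; this is the source of the C*-identity for the operator
    norm.\<close>
  have adj: "cstar (unitization_act u x) * y = cstar x * unitization_act (cstar u) y"
    for u and x y :: 'a
    by (simp add: unitization_act_def cstar_unitization_def cstar_add cstar_mult cstar_cscale
        algebra_simps cscale_simps)
  have le: "norm u * norm u \<le> norm (cstar u * u)" for u :: "'a unitization"
  proof -
    define M where "M = norm (cstar u * u)"
    have "norm (unitization_act u x) \<le> sqrt M * norm x" for x
    proof (rule power2_le_imp_le)
      have "(norm (unitization_act u x))\<^sup>2 = norm (cstar x * unitization_act (cstar u * u) x)"
        by (simp add: power2_eq_square adj unitization_act_simps flip: cstar_identity)
      also have "\<dots> \<le> norm x * (M * norm x)"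
        by (rule order_trans [OF norm_mult_ineq])
          (simp add: M_def mult_left_mono norm_act_le_norm)
      finally show "(norm (unitization_act u x))\<^sup>2 \<le> (sqrt M * norm x)\<^sup>2"
        by (simp add: M_def power_mult_distrib power2_eq_square algebra_simps)
    qed (simp add: M_def)
    then have "onorm (unitization_act u) \<le> sqrt M"
      by (intro onorm_bound) (auto simp: M_def)
    moreover have "cmod (scal_part u) \<le> sqrt M"
      using cmod_scal_part_le [of "cstar u * u"]
      by (intro real_le_rsqrt) (simp add: M_def cstar_unitization_def norm_mult power2_eq_square)
    ultimately have "norm u \<le> sqrt M"
      by (simp add: norm_unitization_def [of u])
    then have "norm u * norm u \<le> sqrt M * sqrt M"
      by (intro mult_mono) (auto simp: M_def)
    then show ?thesis
      by (simp add: M_def)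
  qed
  have le_star: "norm u \<le> norm (cstar u)" for u :: "'a unitization"
  proof (cases "u = 0")
    case False
    have "norm u * norm u \<le> norm (cstar u) * norm u"
      using le norm_mult_ineq order_trans by blast
    with False show ?thesis
      by simp
  qed simp
  have "norm (cstar z * z) \<le> norm z * norm z"
    using norm_mult_ineq [of "cstar z" z] le_star [of "cstar z"] mult_right_mono [of "norm (cstar z)" "norm z" "norm z"]
    by (simp add: invol)
  with le show "norm (cstar z * z) = norm z * norm z"
    by (simp add: antisym)
qed

end

subsection \<open>Positive elements of arbitrary algebras\<close>

lemma Adjoin_simps:
  fixes a b :: "'a::cstar_algebra"
  shows "Adjoin a 0 + Adjoin b 0 = Adjoin (a + b) 0" "Adjoin a 0 - Adjoin b 0 = Adjoin (a - b) 0"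
    "Adjoin a 0 * Adjoin b 0 = Adjoin (a * b) 0" "r *\<^sub>R Adjoin a 0 = Adjoin (r *\<^sub>R a) 0"
    "cstar (Adjoin a 0) = Adjoin (cstar a) 0"
  by (simp_all add: unitization_defs cstar_unitization_def)

text \<open>For the lower bound, left multiplication by \<open>a\<close> is tested on
  \<open>cstar a\<close>.\<close>

lemma norm_Adjoin: "norm (Adjoin a 0) = norm (a::'a::cstar_algebra)"
proof (rule antisym)
  show "norm (Adjoin a 0) \<le> norm a"
    using norm_unitization_le [of "Adjoin a 0"] by simp
  have "norm a * norm a = norm (unitization_act (Adjoin a 0) (cstar a))"
    using cstar_identity [of "cstar a"] by (simp add: unitization_act_def cstar_cstar)
  also have "\<dots> \<le> norm (Adjoin a 0) * norm a"
    using norm_act_le_norm [of "Adjoin a 0" "cstar a"] by simp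
  finally show "norm a \<le> norm (Adjoin a 0)"
    by (cases "a = 0") auto
qed

text \<open>The scalar part is multiplicative, so a square root of \<open>(a, 0)\<close> has vanishing scalar part.\<close>
lemma norm_pos_Adjoin_sqrt:
  fixes a :: "'a::cstar_algebra"
  assumes "norm_pos (Adjoin a 0)"
  obtains r where "cstar r = r" "r * r = a" "norm_pos (Adjoin r 0)"
proof -
  obtain s where s: "norm_pos s" "s * s = Adjoin a 0"
    using norm_pos_sqrt [OF assms] by metis
  then have "scal_part s * scal_part s = 0"
    by (metis unitization.sel(2) unitization_sel(13))
  then obtain r where r: "s = Adjoin r 0"
    by (metis mult_eq_0_iff unitization.collapse)
  show thesis
    using that [of r] s norm_pos_cstar [OF s(1)] by (simp add: r Adjoin_simps)
qed

text \<open>Transfers the results for unital algebras to \<open>cpos\<close>: a root in the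
  unitization comes from the algebra, and star squares are positive.\<close>

lemma norm_pos_Adjoin_iff: "norm_pos (Adjoin a 0) \<longleftrightarrow> cpos (a::'a::cstar_algebra)"
proof
  show "norm_pos (Adjoin a 0) \<Longrightarrow> cpos a"
    by (metis cpos_def norm_pos_Adjoin_sqrt)
  show "cpos a \<Longrightarrow> norm_pos (Adjoin a 0)"
    using norm_pos_star_mult_self [of "Adjoin _ 0"] by (auto simp: cpos_def Adjoin_simps)
qed

lemma cpos_star_mult_self: "cpos (cstar a * a)"
  by (auto simp: cpos_def)

lemma cpos_add: "cpos a \<Longrightarrow> cpos b \<Longrightarrow> cpos (a + b)"
  using norm_pos_add [of "Adjoin a 0" "Adjoin b 0"] by (simp add: Adjoin_simps norm_pos_Adjoin_iff)

lemma cpos_scaleR: "cpos a \<Longrightarrow> r \<ge> 0 \<Longrightarrow> cpos (r *\<^sub>R a)"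
  using norm_pos_scaleR [of "Adjoin a 0" r] by (simp add: Adjoin_simps norm_pos_Adjoin_iff)

lemma norm_mono_cle: "cpos a \<Longrightarrow> cle a b \<Longrightarrow> norm a \<le> norm b"
  using norm_mono_if_norm_pos [of "Adjoin a 0" "Adjoin b 0"]
  by (simp add: cle_def Adjoin_simps norm_Adjoin norm_pos_Adjoin_iff)

lemma cle_trans [trans]: "cle a b \<Longrightarrow> cle b c \<Longrightarrow> cle a c"
  using cpos_add [of "c - b" "b - a"] by (simp add: cle_def)

lemma cle_scaleR: "cle a b \<Longrightarrow> r \<ge> 0 \<Longrightarrow> cle (r *\<^sub>R a) (r *\<^sub>R b)"
  using cpos_scaleR [of "b - a" r] by (simp add: cle_def scaleR_right_diff_distrib)

lemma cle_scaleR_left: "cpos a \<Longrightarrow> r \<le> s \<Longrightarrow> cle (r *\<^sub>R a) (s *\<^sub>R a)"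
  unfolding cle_def using cpos_scaleR [of a "s - r"] by (simp add: scaleR_left_diff_distrib)

text \<open>In the unitization \<open>a\<close> is at most \<open>norm a\<close> times the unit;
  conjugating by \<open>c\<close> brings the inequality back into the algebra.\<close>

lemma cle_norm_congruence:
  fixes a c :: "'a::cstar_algebra"
  assumes "cpos a"
  shows "cle (cstar c * a * c) (norm a *\<^sub>R (cstar c * c))"
proof -
  have a: "norm_pos (Adjoin a 0)"
    using assms by (simp add: norm_pos_Adjoin_iff)
  then have "norm_pos (norm a *\<^sub>R 1 - Adjoin a 0)"
    by (intro norm_pos_diff) (simp_all add: norm_pos_cstar norm_Adjoin)
  then have "norm_pos (cstar (Adjoin c 0) * (norm a *\<^sub>R 1 - Adjoin a 0) * Adjoin c 0)"
    by (rule norm_pos_congruence)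
  then show ?thesis
    by (simp add: cle_def Adjoin_simps left_diff_distrib right_diff_distrib flip: norm_pos_Adjoin_iff)
qed

text \<open>The description in \<open>cstar_sqrt\<close> is well defined: existence comes from a
  root with zero scalar part, uniqueness from the unitization.\<close>

lemma cstar_sqrt:
  assumes "cpos (a::'a::cstar_algebra)"
  shows "cpos (cstar_sqrt a)" "cstar_sqrt a * cstar_sqrt a = a"
proof -
  have "norm_pos (Adjoin a 0)"
    using assms by (simp add: norm_pos_Adjoin_iff)
  then obtain r where r: "cpos r" "r * r = a"
    using norm_pos_Adjoin_sqrt [of a] by (auto simp: norm_pos_Adjoin_iff)
  have "\<exists>!b. cpos b \<and> b * b = a"
  proof (rule ex1I [of _ r])
    fix b assume b: "cpos b \<and> b * b = a"
    then have "Adjoin b 0 = Adjoin r 0"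
      using r norm_pos_sqrt_unique [of "Adjoin b 0" "Adjoin r 0"]
      by (simp add: norm_pos_Adjoin_iff Adjoin_simps)
    then show "b = r"
      by simp
  qed (use r in simp)
  from theI' [OF this] show "cpos (cstar_sqrt a)" "cstar_sqrt a * cstar_sqrt a = a"
    by (simp_all add: cstar_sqrt_def)
qed

lemma cle_if_square_cle:
  fixes a b :: "'a::cstar_algebra"
  assumes "cpos a" "cpos b" "cle (a * a) (b * b)"
  shows "cle a b"
  using norm_pos_sqrt_mono [of "Adjoin a 0" "Adjoin b 0"] assms
  by (simp add: cle_def Adjoin_simps norm_pos_Adjoin_iff)

lemma cle_sqrt_scaleR_sqrt:
  fixes a b :: "'a::cstar_algebra"
  assumes "cpos a" "cpos b" "r \<ge> 0" "cle a (r *\<^sub>R b)"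
  shows "cle (cstar_sqrt a) (sqrt r *\<^sub>R cstar_sqrt b)"
  by (rule cle_if_square_cle) (use assms in \<open>simp_all add: cpos_scaleR cstar_sqrt\<close>)

subsection \<open>Hilbert modules\<close>

locale cstar_module =
  fixes ip :: "'x::cvector \<Rightarrow> 'x \<Rightarrow> 'a::cstar_algebra" and rm :: "'x \<Rightarrow> 'a \<Rightarrow> 'x"
  assumes module: "hilbert_cstar_module ip rm"
begin

lemma ip_add_right: "ip x (y + z) = ip x y + ip x z"
  and ip_cscale_right: "ip x (c *\<^sub>C y) = c *\<^sub>C ip x y"
  and ip_rm_right: "ip x (rm y a) = ip x y * a"
  and cstar_ip: "cstar (ip x y) = ip y x"
  and cpos_ip: "cpos (ip x x)"
  and ip_eq_0: "ip x x = 0 \<Longrightarrow> x = 0"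
  using module by (simp_all add: hilbert_cstar_module_def)

lemma ip_scaleR_right: "ip x (r *\<^sub>R y) = r *\<^sub>R ip x y"
  by (simp add: scaleR_cscale ip_cscale_right)

lemma ip_diff_right: "ip x (y - z) = ip x y - ip x z"
  using ip_add_right [of x "y - z" z] by simp

lemma ip_add_left: "ip (x + y) z = ip x z + ip y z"
  by (metis cstar_add cstar_ip ip_add_right)

lemma ip_scaleR_left: "ip (r *\<^sub>R x) y = r *\<^sub>R ip x y"
  by (metis cstar_scaleR cstar_ip ip_scaleR_right)

lemma ip_diff_left: "ip (x - y) z = ip x z - ip y z"
  by (metis cstar_diff cstar_ip ip_diff_right)

lemma ip_rm_left: "ip (rm x a) y = cstar a * ip x y"
  by (metis cstar_mult cstar_ip ip_rm_right)

lemma ip_zero_left: "ip 0 x = 0"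
  using ip_scaleR_left [of 0 0 x] by simp

lemmas ip_simps = ip_add_left ip_add_right ip_diff_left ip_diff_right ip_scaleR_left ip_scaleR_right

lemma cauchy_schwarz:
  "cle (cstar (ip x y) * ip x y) (norm (ip x x) *\<^sub>R ip y y)"
proof (cases "x = 0")
  case True
  then show ?thesis
    by (simp add: cle_def ip_zero_left cpos_def exI [of _ 0])
next
  case False
  define N where "N = norm (ip x x)"
  define c where "c = ip x y"
  have N: "N > 0"
    using False ip_eq_0 by (auto simp: N_def)
  have c: "cstar c = ip y x"
    by (simp add: c_def cstar_ip)
  \<comment> \<open>Expanding the positive element \<open>ip z z\<close> and bounding
    \<open>cstar c * ip x x * c\<close> by \<open>N (cstar c * c)\<close> leaves \<open>N\<close>
    times the desired difference.\<close>
  define z where "z = rm x c - N *\<^sub>R y"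
  have "ip z z = cstar c * ip x x * c - (2 * N) *\<^sub>R (cstar c * c) + (N * N) *\<^sub>R ip y y"
    by (simp add: z_def ip_simps ip_rm_left ip_rm_right c_def [symmetric] c [symmetric]
        algebra_simps scaleR_2 flip: scaleR_scaleR)
  then have "ip z z + (N *\<^sub>R (cstar c * c) - cstar c * ip x x * c)
      = N *\<^sub>R (N *\<^sub>R ip y y - cstar c * c)"
    by (simp add: algebra_simps scaleR_2 flip: scaleR_scaleR)
  moreover have "cpos (N *\<^sub>R (cstar c * c) - cstar c * ip x x * c)"
    using cle_norm_congruence [OF cpos_ip] by (simp add: cle_def N_def)
  ultimately have "cpos (N *\<^sub>R (N *\<^sub>R ip y y - cstar c * c))"
    by (metis cpos_add cpos_ip)
  then have "cpos (inverse N *\<^sub>R (N *\<^sub>R (N *\<^sub>R ip y y - cstar c * c)))"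
    by (rule cpos_scaleR) (use N in simp)
  then show ?thesis
    using N by (simp add: cle_def N_def c_def)
qed

text \<open>The free bound \<open>r\<close> allows \<open>x\<close> to be \<open>w - K w\<close>
  while the constant is the norm of \<open>ip w w\<close>.\<close>

lemma cle_cabs_ip:
  assumes "norm (ip x x) \<le> r"
  shows "cle (cabs (ip x y)) (sqrt r *\<^sub>R cstar_sqrt (ip y y))"
  unfolding cabs_def
proof (rule cle_sqrt_scaleR_sqrt)
  show "cle (cstar (ip x y) * ip x y) (r *\<^sub>R ip y y)"
    using cauchy_schwarz cle_scaleR_left [OF cpos_ip assms] by (rule cle_trans)
  show "r \<ge> 0"
    using assms norm_ge_zero order_trans by blast
qed (simp_all add: cpos_ip cpos_star_mult_self)

text \<open>With \<open>d = (v - u)/2\<close> one has \<open>x - u = d + w\<close> and \<open>v - x = d - w\<close>, and the cross terms of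
  \<open>\<langle>d + w, d - w\<rangle>\<close> are skew-adjoint.\<close>
lemma cRe_ip_diff:
  fixes x u v :: 'x
  defines "w \<equiv> x - (1/2) *\<^sub>R (u + v)"
  shows "cRe (ip (x - u) (v - x)) = (1/4) *\<^sub>R ip (v - u) (v - u) - ip w w"
proof -
  define d where "d = (1/2) *\<^sub>R (v - u)"
  have half: "(1/2) *\<^sub>R z + (1/2) *\<^sub>R z = z" for z :: 'x
    by (simp flip: scaleR_left_distrib)
  have e: "x - u = d + w" "v - x = d - w"
    using half [of u] half [of v] by (simp_all add: d_def w_def algebra_simps)
  have "ip (d + w) (d - w) + cstar (ip (d + w) (d - w)) = 2 *\<^sub>R (ip d d - ip w w)"
    by (simp add: ip_simps cstar_add cstar_diff cstar_ip scaleR_2 algebra_simps)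
  then have "cRe (ip (d + w) (d - w)) = ip d d - ip w w"
    by (simp add: cRe_def)
  moreover have "ip d d = (1/4) *\<^sub>R ip (v - u) (v - u)"
    by (simp add: d_def ip_scaleR_left ip_scaleR_right)
  ultimately show ?thesis
    by (simp only: e)
qed

lemma mabs_mult_self: "mabs ip z * mabs ip z = ip z z"
  by (simp add: mabs_def cstar_sqrt cpos_ip)

section \<open>Projections on a Hilbert module\<close>

context
  fixes K :: "'x \<Rightarrow> 'x"
  assumes K: "module_projection ip K"
begin

lemma projection_adjoint: "ip (K x) y = ip x (K y)"
  and projection_idem: "K (K x) = K x"
  using K unfolding module_projection_def by (auto simp: fun_eq_iff)

lemma ip_minus_projection_shift:
  assumes "m \<in> range K" "m' \<in> range K"
  shows "ip (w + r *\<^sub>R m) (w' + s *\<^sub>R m') - ip (K (w + r *\<^sub>R m)) (w' + s *\<^sub>R m') = ip (w - K w) w'"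
proof -
  have m: "K m = m" "K m' = m'"
    using assms projection_idem by auto
  have r: "ip (K z) m' = ip z m'" for z
    by (simp add: projection_adjoint m)
  \<comment> \<open>Additivity of \<open>K\<close> is obtained weakly, by moving \<open>K\<close> to
    the other argument and back.\<close>
  have l: "ip (K (w + r *\<^sub>R m)) z = ip (K w) z + r *\<^sub>R ip m z" for z
    by (simp add: projection_adjoint ip_simps) (simp add: m flip: projection_adjoint)
  show ?thesis
    by (simp add: l ip_simps r)
qed

text \<open>Pythagoras: \<open>ip w w\<close> exceeds the left-hand inner product by the positive
  element \<open>ip (K w) (K w)\<close>.\<close>

lemma norm_ip_minus_projection_le: "norm (ip (w - K w) (w - K w)) \<le> norm (ip w w)"
proof (rule norm_mono_cle)
  have "ip w w - ip (w - K w) (w - K w) = ip (K w) (K w)"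
    by (simp add: ip_simps projection_adjoint projection_idem)
  then show "cle (ip (w - K w) (w - K w)) (ip w w)"
    by (simp add: cle_def cpos_ip)
qed (rule cpos_ip)

end

end

theorem theorem4p2:
  fixes ip :: "'x::cvector \<Rightarrow> 'x \<Rightarrow> 'a::cstar_algebra" and rm :: "'x \<Rightarrow> 'a \<Rightarrow> 'x"
    and K :: "'x \<Rightarrow> 'x" and x y u v u' v' :: 'x
  assumes "hilbert_cstar_module ip rm"
    and "cpos (cRe (ip (x - u) (v - x)))"
    and "cpos (cRe (ip (y - u') (v' - y)))"
    and "module_projection ip K"
    and "u + v \<in> range K" and "u' + v' \<in> range K"
  shows "cle (cabs (ip x y - ip (K x) y))
           (sqrt (norm ((1/4) *\<^sub>R (mabs ip (v - u) * mabs ip (v - u)) - cRe (ip (x - u) (v - x))))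
             *\<^sub>R cstar_sqrt ((1/4) *\<^sub>R (mabs ip (v' - u') * mabs ip (v' - u')) - cRe (ip (y - u') (v' - y))))
       \<and> cle (sqrt (norm ((1/4) *\<^sub>R (mabs ip (v - u) * mabs ip (v - u)) - cRe (ip (x - u) (v - x))))
             *\<^sub>R cstar_sqrt ((1/4) *\<^sub>R (mabs ip (v' - u') * mabs ip (v' - u')) - cRe (ip (y - u') (v' - y))))
           ((1/4 * mnorm ip (v - u)) *\<^sub>R mabs ip (v' - u'))"
proof -
  interpret M: cstar_module ip rm
    by unfold_locales fact
  define w where "w = x - (1/2) *\<^sub>R (u + v)"
  define w' where "w' = y - (1/2) *\<^sub>R (u' + v')"
  have Re: "cRe (ip (x - u) (v - x)) = (1/4) *\<^sub>R ip (v - u) (v - u) - ip w w"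
    "cRe (ip (y - u') (v' - y)) = (1/4) *\<^sub>R ip (v' - u') (v' - u') - ip w' w'"
    unfolding w_def w'_def by (rule M.cRe_ip_diff)+
  have eq: "ip x y - ip (K x) y = ip (w - K w) w'"
    using M.ip_minus_projection_shift [OF assms(4-6), of w "1/2" w' "1/2"]
    by (simp add: w_def w'_def)
  \<comment> \<open>By \<open>Re\<close>, the two positivity hypotheses are exactly these
    bounds.\<close>
  have le: "cle (ip w w) ((1/4) *\<^sub>R ip (v - u) (v - u))"
    "cle (ip w' w') ((1/4) *\<^sub>R ip (v' - u') (v' - u'))"
    using assms(2,3) by (simp_all add: Re cle_def)
  have n: "norm (ip w w) \<le> 1/4 * norm (ip (v - u) (v - u))"
    using norm_mono_cle [OF M.cpos_ip le(1)] by simp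
  have "cle (cabs (ip (w - K w) w')) (sqrt (norm (ip w w)) *\<^sub>R cstar_sqrt (ip w' w'))"
    by (rule M.cle_cabs_ip [OF M.norm_ip_minus_projection_le [OF assms(4)]])
  moreover have "cle (sqrt (norm (ip w w)) *\<^sub>R cstar_sqrt (ip w' w'))
      ((1/4 * mnorm ip (v - u)) *\<^sub>R mabs ip (v' - u'))"
  \<comment> \<open>After squaring, the bounds for \<open>w\<close> and \<open>w'\<close> apply one
    after the other; their constants multiply to 1/16, the square of 1/4.\<close>
  proof (rule cle_if_square_cle)
    have "cle (norm (ip w w) *\<^sub>R ip w' w') ((1/4 * norm (ip (v - u) (v - u))) *\<^sub>R ip w' w')"
      by (rule cle_scaleR_left [OF M.cpos_ip n])
    also have "cle ((1/4 * norm (ip (v - u) (v - u))) *\<^sub>R ip w' w')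
        ((1/4 * norm (ip (v - u) (v - u))) *\<^sub>R ((1/4) *\<^sub>R ip (v' - u') (v' - u')))"
      by (rule cle_scaleR [OF le(2)]) simp
    finally have "cle (norm (ip w w) *\<^sub>R ip w' w')
        ((1/16 * norm (ip (v - u) (v - u))) *\<^sub>R ip (v' - u') (v' - u'))"
      by simp
    then show "cle (sqrt (norm (ip w w)) *\<^sub>R cstar_sqrt (ip w' w') * sqrt (norm (ip w w)) *\<^sub>R cstar_sqrt (ip w' w'))
        ((1/4 * mnorm ip (v - u)) *\<^sub>R mabs ip (v' - u') * (1/4 * mnorm ip (v - u)) *\<^sub>R mabs ip (v' - u'))"
      by (simp add: cstar_sqrt M.cpos_ip M.mabs_mult_self mnorm_def)
  qed (simp_all add: cpos_scaleR cstar_sqrt M.cpos_ip mabs_def mnorm_def)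
  ultimately show ?thesis
    by (simp add: eq Re M.mabs_mult_self)
qed

end
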